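(* Let $\mathcal{X}$ and $\mathcal{Y}$ be Banach spaces and let $A\in\mathcal{L}(\mathcal{X},\mathcal{Y})$ and closed subspaces $\mathcal{T}\subseteq\mathcal{X}$, $\mathcal{S}\subseteq\mathcal{Y}$ be such that $A^{(2)}_{\mathcal{T},\mathcal{S}}$ exists. Let $(A_n)_{n\in\mathbb{N}}\subset\mathcal{L}(\mathcal{X},\mathcal{Y})$ and let $(\mathcal{T}_n)_{n\in\mathbb{N}}$ and $(\mathcal{S}_n)_{n\in\mathbb{N}}$ be sequences of closed subspaces of $\mathcal{X}$ and $\mathcal{Y}$, respectively, such that $(A_n)^{(2)}_{\mathcal{T}_n,\mathcal{S}_n}$ exists for each $n\in\mathbb{N}$. Suppose that $(A_n)_{n\in\mathbb{N}}$ converges to $A$. The following statements are equivalent (limits as $n\to\infty$, operators in the operator norm). (i) $(A_n)^{(2)}_{\mathcal{T}_n,\mathcal{S}_n}\to A^{(2)}_{\mathcal{T},\mathcal{S}}$. (ii) $(A_n)^{(2)}_{\mathcal{T}_n,\mathcal{S}_n}A_n\to A^{(2)}_{\mathcal{T},\mathcal{S}}A$ and $A_n(A_n)^{(2)}_{\mathcal{T}_n,\mathcal{S}_n}\to AA^{(2)}_{\mathcal{T},\mathcal{S}}$. (iii) $(A_n)^{(2)}_{\mathcal{T}_n,\mathcal{S}_n}A_n\to A^{(2)}_{\mathcal{T},\mathcal{S}}A$ and $\widehat{\delta}(\mathcal{S}_n,\mathcal{S})\to0$. (iv) $A_n(A_n)^{(2)}_{\mathcal{T}_n,\mathcal{S}_n}\to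 AA^{(2)}_{\mathcal{T},\mathcal{S}}$ and $\widehat{\delta}(\mathcal{T}_n,\mathcal{T})\to0$. (v) $\widehat{\delta}(\mathcal{T}_n,\mathcal{T})\to0$ and $\widehat{\delta}(\mathcal{S}_n,\mathcal{S})\to0$.
   Context: For $A\in\mathcal{L}(\mathcal{X},\mathcal{Y})$ (bounded linear operators) and closed subspaces $\mathcal{T}\subseteq\mathcal{X}$, $\mathcal{S}\subseteq\mathcal{Y}$, the outer inverse $A^{(2)}_{\mathcal{T},\mathcal{S}}$ is the (necessarily unique, if it exists) operator $B\in\mathcal{L}(\mathcal{Y},\mathcal{X})$ with $BAB=B$, range $\mathcal{R}(B)=\mathcal{T}$ and null space $\mathcal{N}(B)=\mathcal{S}$. For closed subspaces $\mathcal{M},\mathcal{N}$ of a Banach space, $\delta(\mathcal{M},\mathcal{N})=0$ if $\mathcal{M}=0$, otherwise $\delta(\mathcal{M},\mathcal{N})=\sup\{\mathrm{dist}(x,\mathcal{N}): x\in\mathcal{M},\|x\|=1\}$; the gap is $\widehat{\delta}(\mathcal{M},\mathcal{N})=\max\{\delta(\mathcal{M},\mathcal{N}),\delta(\mathcal{N},\mathcal{M})\}$. *)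

theory Defs
  imports "HOL-Analysis.Analysis"
begin

definition is_outer_inverse ::
  "('a::real_normed_vector \<Rightarrow>\<^sub>L 'b::real_normed_vector) \<Rightarrow> 'a set \<Rightarrow> 'b set \<Rightarrow> ('b \<Rightarrow>\<^sub>L 'a) \<Rightarrow> bool"
  where "is_outer_inverse A T S B \<longleftrightarrow>
    B o\<^sub>L A o\<^sub>L B = B \<and> range (blinfun_apply B) = T \<and> {y. blinfun_apply B y = 0} = S"

lemma is_outer_inverse_unique:
  assumes B: "is_outer_inverse A T S B" and C: "is_outer_inverse A T S C"
  shows "B = C"
proof (rule blinfun_eqI)
  fix y
  have BAB: "B (A (B z)) = B z" for z
    using B unfolding is_outer_inverse_def by (metis blinfun_apply_blinfun_compose)
  have CAC: "C (A (C z)) = C z" for z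
    using C unfolding is_outer_inverse_def by (metis blinfun_apply_blinfun_compose)
  have ker: "B z = 0 \<longleftrightarrow> C z = 0" for z
    using B C unfolding is_outer_inverse_def by blast
  have "B y \<in> range C"
    using B C unfolding is_outer_inverse_def by blast
  then obtain z where z: "B y = C z" by blast
  have "B (y - A (B y)) = 0"
    by (simp add: blinfun.diff_right BAB)
  then have "C y = C (A (B y))"
    by (metis ker blinfun.diff_right eq_iff_diff_eq_0)
  also have "\<dots> = B y"
    using z CAC by simp
  finally show "B y = C y" by simp
qed

definition outer_inverse_exists ::
  "('a::real_normed_vector \<Rightarrow>\<^sub>L 'b::real_normed_vector) \<Rightarrow> 'a set \<Rightarrow> 'b set \<Rightarrow> bool"
  where "outer_inverse_exists A T S \<longleftrightarrow> (\<exists>B. is_outer_inverse A T S B)"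

definition outer_inverse ::
  "('a::real_normed_vector \<Rightarrow>\<^sub>L 'b::real_normed_vector) \<Rightarrow> 'a set \<Rightarrow> 'b set \<Rightarrow> ('b \<Rightarrow>\<^sub>L 'a)"
  where "outer_inverse A T S = (THE B. is_outer_inverse A T S B)"

lemma is_outer_inverse_outer_inverse:
  assumes "outer_inverse_exists A T S"
  shows "is_outer_inverse A T S (outer_inverse A T S)"
  using assms is_outer_inverse_unique
  unfolding outer_inverse_exists_def outer_inverse_def by (metis theI)

text \<open>For \<open>N\<close> a subspace the distances below lie in \<open>[0, 1]\<close>, as \<open>0 \<in> N\<close>; and a subspace
  \<open>M \<noteq> {0}\<close> contains unit vectors. So the real-valued supremum is
  taken over a nonempty bounded set.\<close>

definition gap_delta :: "'a::real_normed_vector set \<Rightarrow> 'a set \<Rightarrow> real"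
  where "gap_delta M N =
    (if M = {0} then 0 else SUP x\<in>{x \<in> M. norm x = 1}. infdist x N)"

definition gap :: "'a::real_normed_vector set \<Rightarrow> 'a set \<Rightarrow> real"
  where "gap M N = max (gap_delta M N) (gap_delta N M)"

end

theory Submission
  imports Defs
begin

text \<open>With \<open>B = outer_inverse A T S\<close> the operators \<open>B A\<close> and \<open>1 - A B\<close> are bounded projections onto
  \<open>T\<close> and \<open>S\<close>, and the gap between the ranges of two projections is at most the norm of their
  difference; hence norm convergence of these projections controls the gaps. Conversely, split
  \[ C y - B y = (1 - B A) C y + B (A - D) C y + B (D C y - y) \]
  for \<open>C = outer_inverse D T' S'\<close>. Here \<open>C y \<in> T'\<close> and \<open>1 - B A\<close> vanishes on \<open>T\<close>, while \<open>D C y - y \<in> S'\<close>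
  and \<open>B\<close> vanishes on \<open>S\<close>, so the outer terms are controlled by the gaps. This bounds the norm
  of \<open>C - B\<close> by a small multiple of the norm of \<open>C\<close> plus a small constant, and the first
  term can be absorbed.\<close>

lemma bdd_above_infdist_unit:
  assumes "subspace N"
  shows "bdd_above ((\<lambda>x. infdist x N) ` {x \<in> M. norm x = 1})"
proof (rule bdd_aboveI2)
  fix x assume "x \<in> {x \<in> M. norm x = 1}"
  then show "infdist x N \<le> 1"
    using infdist_le[OF subspace_0[OF assms], of x] by simp
qed

lemma infdist_le_gap_delta:
  assumes "subspace N" "x \<in> M" "norm x = 1"
  shows "infdist x N \<le> gap_delta M N"
proof -
  have "M \<noteq> {0}" using assms by auto
  then show ?thesis
    using cSUP_upper[OF _ bdd_above_infdist_unit[OF assms(1)], of x M] assms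
    by (simp add: gap_delta_def)
qed

lemma subspace_unit_vector:
  assumes "subspace M" "M \<noteq> {0}"
  obtains x where "x \<in> M" "norm x = 1"
proof -
  obtain y where "y \<in> M" "y \<noteq> 0"
    using assms subspace_0 by blast
  then show ?thesis
    using that[of "y /\<^sub>R norm y"] subspace_scale[OF assms(1)] by simp
qed

lemma gap_delta_nonneg:
  assumes "subspace M" "subspace N"
  shows "0 \<le> gap_delta M N"
proof (cases "M = {0}")
  case False
  then obtain x where "x \<in> M" "norm x = 1"
    using subspace_unit_vector assms(1) by blast
  then show ?thesis
    using infdist_le_gap_delta[OF assms(2)] infdist_nonneg order_trans by blast
qed (simp add: gap_delta_def)

text \<open>The condition \<open>0 \<le> c\<close> covers \<open>M = {0}\<close>, where there are no
  unit vectors and \<open>gap_delta\<close> is 0 by convention.\<close>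

lemma gap_delta_least:
  assumes "subspace M" "0 \<le> c" "\<And>x. x \<in> M \<Longrightarrow> norm x = 1 \<Longrightarrow> infdist x N \<le> c"
  shows "gap_delta M N \<le> c"
proof (cases "M = {0}")
  case False
  then have "{x \<in> M. norm x = 1} \<noteq> {}"
    using subspace_unit_vector assms(1) by blast
  then show ?thesis
    using False assms(3) by (auto simp: gap_delta_def intro!: cSUP_least)
qed (simp add: gap_delta_def assms(2))

text \<open>For a unit vector \<open>x = P x\<close> of \<open>M\<close>, the point
  \<open>P' x\<close> of \<open>N\<close> is a competitor for the distance to \<open>N\<close>, at
  distance \<open>norm ((P' - P) x)\<close>.\<close>

lemma gap_delta_le_norm_diff:
  fixes P P' :: "'a::real_normed_vector \<Rightarrow>\<^sub>L 'a"
  assumes "subspace M" "\<And>x. x \<in> M \<Longrightarrow> P x = x" "\<And>x. P' x \<in> N"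
  shows "gap_delta M N \<le> norm (P' - P)"
proof (rule gap_delta_least[OF assms(1)])
  fix x assume x: "x \<in> M" "norm x = 1"
  have "infdist x N \<le> dist x (P' x)"
    by (rule infdist_le[OF assms(3)])
  also have "\<dots> = norm ((P' - P) x)"
    using assms(2)[OF x(1)] by (simp add: dist_norm norm_minus_commute blinfun.diff_left)
  also have "\<dots> \<le> norm (P' - P)"
    using norm_blinfun[of "P' - P" x] x by simp
  finally show "infdist x N \<le> norm (P' - P)" .
qed simp

lemma gap_projections_tendsto_0:
  fixes P :: "'a::real_normed_vector \<Rightarrow>\<^sub>L 'a" and P' :: "nat \<Rightarrow> 'a \<Rightarrow>\<^sub>L 'a"
  assumes "subspace M" "\<And>x. P x \<in> M" "\<And>x. x \<in> M \<Longrightarrow> P x = x"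
    and "\<And>n. subspace (M' n)" "\<And>n x. P' n x \<in> M' n" "\<And>n x. x \<in> M' n \<Longrightarrow> P' n x = x"
    and "P' \<longlonglongrightarrow> P"
  shows "(\<lambda>n. gap (M' n) M) \<longlonglongrightarrow> 0"
proof (rule tendsto_sandwich)
  have "gap (M' n) M \<le> norm (P' n - P)" for n
    \<comment> \<open>The two one-sided gaps are bounded by the same estimate with the roles of the
      projections exchanged.\<close>
    using gap_delta_le_norm_diff[where M = M and P = P and P' = "P' n" and N = "M' n"]
      gap_delta_le_norm_diff[where M = "M' n" and P = "P' n" and P' = P and N = M] assms
    by (simp add: gap_def norm_minus_commute)
  then show "\<forall>\<^sub>F n in sequentially. gap (M' n) M \<le> norm (P' n - P)" by simp
  show "\<forall>\<^sub>F n in sequentially. 0 \<le> gap (M' n) M"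
    using assms by (simp add: gap_def gap_delta_nonneg le_max_iff_disj)
  show "(\<lambda>n. norm (P' n - P)) \<longlonglongrightarrow> 0"
    using assms(7) by (simp add: LIM_zero tendsto_norm_zero)
qed simp

text \<open>Since \<open>L x = L (x - y)\<close> for every \<open>y\<close> in \<open>N\<close>, the
  bound \<open>norm L * dist x y\<close> can be minimised over \<open>y\<close>. Nonemptiness
  matters because \<open>infdist x {}\<close> is 0 by default.\<close>

lemma norm_blinfun_le_infdist:
  fixes L :: "'a::real_normed_vector \<Rightarrow>\<^sub>L 'b::real_normed_vector"
  assumes "N \<noteq> {}" "\<And>x. x \<in> N \<Longrightarrow> L x = 0"
  shows "norm (L x) \<le> norm L * infdist x N"
proof (cases "L = 0")
  case False
  \<comment> \<open>Dividing by \<open>norm L\<close> leaves a bare infimum on the right; this is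
    why \<open>L = 0\<close> is split off.\<close>
  have "norm (L x) / norm L \<le> infdist x N"
    unfolding infdist_notempty[OF assms(1)]
  proof (rule cINF_greatest[OF assms(1)])
    fix y assume "y \<in> N"
    then have "norm (L x) = norm (L (x - y))"
      using assms(2) by (simp add: blinfun.diff_right)
    also have "\<dots> \<le> norm L * dist x y"
      unfolding dist_norm by (rule norm_blinfun)
    finally show "norm (L x) / norm L \<le> dist x y"
      using False by (simp add: divide_le_eq mult.commute)
  qed
  then show ?thesis
    using False by (simp add: divide_le_eq mult.commute)
qed simp

text \<open>An operator vanishing on \<open>N\<close> is small on every subspace close to
  \<open>N\<close>. The gap only sees unit vectors, so \<open>x\<close> is normalised and the
  estimate scaled back.\<close>

lemma norm_blinfun_le_gap:
  fixes L :: "'a::real_normed_vector \<Rightarrow>\<^sub>L 'b::real_normed_vector"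
  assumes "subspace M" "subspace N" "\<And>x. x \<in> N \<Longrightarrow> L x = 0" "x \<in> M"
  shows "norm (L x) \<le> norm L * gap M N * norm x"
proof (cases "x = 0")
  case False
  define e where "e = x /\<^sub>R norm x"
  have e: "e \<in> M" "norm e = 1" and x: "x = norm x *\<^sub>R e"
    using False assms subspace_scale by (auto simp: e_def)
  have "norm (L e) \<le> norm L * infdist e N"
    using norm_blinfun_le_infdist assms subspace_0 by blast
  also have "infdist e N \<le> gap M N"
    using infdist_le_gap_delta[OF assms(2) e] by (simp add: gap_def)
  finally have "norm (L e) \<le> norm L * gap M N"
    by (simp add: mult_left_mono)
  moreover have "norm (L x) = norm x * norm (L e)"
    by (subst x) (simp add: blinfun.scaleR_right)
  ultimately show ?thesis
    by (simp add: mult.commute mult_left_mono)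
qed simp

text \<open>The identity \<open>B A B = B\<close> makes \<open>B A\<close> fix the range
  \<open>T\<close>; it also gives \<open>B (y - A (B y)) = 0\<close>, which places
  \<open>y - A (B y)\<close> in \<open>S\<close>.\<close>

lemma is_outer_inverseD:
  assumes "is_outer_inverse A T S B"
  shows "B (A (B y)) = B y" "B y \<in> T" "x \<in> T \<Longrightarrow> B (A x) = x" "y \<in> S \<longleftrightarrow> B y = 0"
proof -
  show BAB: "B (A (B y)) = B y" for y
    using assms unfolding is_outer_inverse_def by (metis blinfun_apply_blinfun_compose)
  show "B y \<in> T" "y \<in> S \<longleftrightarrow> B y = 0"
    using assms unfolding is_outer_inverse_def by auto
  show "B (A x) = x" if "x \<in> T"
    using that BAB assms unfolding is_outer_inverse_def by auto
qed

text \<open>\<open>norm C\<close> stays on the right because no bound on it is known beforehand. All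
  other factors come from the fixed \<open>A\<close>, \<open>B\<close>, from \<open>D\<close>, or
  are small.\<close>

lemma norm_outer_inverse_diff_le:
  fixes A D :: "'a::real_normed_vector \<Rightarrow>\<^sub>L 'b::real_normed_vector"
  assumes "subspace T" "subspace S" and B: "is_outer_inverse A T S B"
    and "subspace T'" "subspace S'" and C: "is_outer_inverse D T' S' C"
  defines "a \<equiv> norm (id_blinfun - (B o\<^sub>L A)) * gap T' T + norm B * norm (A - D)
    + norm B * gap S' S * norm D"
  shows "norm (C - B) \<le> a * norm C + norm B * gap S' S"
proof -
  define s where "s = norm B * gap S' S"
  have gap_nonneg: "0 \<le> gap T' T" "0 \<le> gap S' S"
    using assms by (simp_all add: gap_def gap_delta_nonneg le_max_iff_disj)
  then have nonneg: "0 \<le> a" "0 \<le> s"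
    by (simp_all add: a_def s_def)
  show ?thesis
  proof (rule norm_blinfun_bound)
    show "0 \<le> a * norm C + norm B * gap S' S"
      using nonneg by (simp add: s_def)
    fix y
    define w where "w = C y"
    have 1: "norm ((id_blinfun - (B o\<^sub>L A)) w)
        \<le> norm (id_blinfun - (B o\<^sub>L A)) * gap T' T * norm w"
      using is_outer_inverseD[OF B] is_outer_inverseD[OF C] assms
      by (intro norm_blinfun_le_gap) (auto simp: w_def blinfun.diff_left)
    have 2: "norm (B ((A - D) w)) \<le> norm B * norm (A - D) * norm w"
        unfolding mult.assoc
      by (rule order_trans[OF norm_blinfun mult_left_mono[OF norm_blinfun norm_ge_zero]])
    \<comment> \<open>\<open>C D C = C\<close> yields \<open>C (D w - y) = 0\<close>, so this vector
      lies in \<open>S'\<close>, while \<open>B\<close> vanishes on \<open>S\<close>.\<close>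
    have "norm (B (D w - y)) \<le> s * norm (D w - y)"
      using is_outer_inverseD[OF B] is_outer_inverseD[OF C] assms unfolding s_def
      by (intro norm_blinfun_le_gap) (auto simp: w_def blinfun.diff_right)
    also have "norm (D w - y) \<le> norm D * norm w + norm y"
      using norm_triangle_ineq4[of "D w" y] norm_blinfun[of D w] by linarith
    finally have 3: "norm (B (D w - y)) \<le> s * (norm D * norm w + norm y)"
      using nonneg by (simp add: mult_left_mono)
    \<comment> \<open>The sum telescopes: \<open>B (A w)\<close> and \<open>B (D w)\<close> cancel,
      leaving \<open>w - B y\<close>.\<close>
    have "(C - B) y = (id_blinfun - (B o\<^sub>L A)) w + B ((A - D) w) + B (D w - y)"
      by (simp add: w_def blinfun.diff_left blinfun.diff_right)
    then have "norm ((C - B) y) \<le> norm ((id_blinfun - (B o\<^sub>L A)) w) + norm (B ((A - D) w))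
        + norm (B (D w - y))"
      by (simp only:) (intro norm_triangle_mono order_refl)
    also have "\<dots> \<le> a * norm w + s * norm y"
      using 1 2 3 by (simp add: a_def s_def algebra_simps)
    also have "\<dots> \<le> a * (norm C * norm y) + s * norm y"
      unfolding w_def using nonneg by (simp add: mult_left_mono norm_blinfun)
    finally show "norm ((C - B) y) \<le> (a * norm C + norm B * gap S' S) * norm y"
      by (simp add: s_def algebra_simps)
  qed
qed

lemma outer_inverse_tendsto:
  fixes A :: "'a::real_normed_vector \<Rightarrow>\<^sub>L 'b::real_normed_vector"
  assumes "subspace T" "subspace S" "is_outer_inverse A T S B"
    and "\<And>n. subspace (T' n)" "\<And>n. subspace (S' n)"
    and "\<And>n. is_outer_inverse (A' n) (T' n) (S' n) (B' n)"
    and "A' \<longlonglongrightarrow> A" "(\<lambda>n. gap (T' n) T) \<longlonglongrightarrow> 0" "(\<lambda>n. gap (S' n) S) \<longlonglongrightarrow> 0"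
  shows "B' \<longlonglongrightarrow> B"
proof -
  define a where "a n = norm (id_blinfun - (B o\<^sub>L A)) * gap (T' n) T + norm B * norm (A - A' n)
    + norm B * gap (S' n) S * norm (A' n)" for n
  \<comment> \<open>The factor 2 is the price of absorbing half of \<open>norm (B' n - B)\<close>
    into the left-hand side.\<close>
  define c where "c n = 2 * (a n * norm B + norm B * gap (S' n) S)" for n
  have "a \<longlonglongrightarrow> norm (id_blinfun - (B o\<^sub>L A)) * 0 + norm B * norm (A - A) + norm B * 0 * norm A"
    unfolding a_def by (intro tendsto_intros assms)
  then have a: "a \<longlonglongrightarrow> 0" by simp
  have "c \<longlonglongrightarrow> 2 * (0 * norm B + norm B * 0)"
    unfolding c_def by (intro tendsto_intros assms a)
  then have c: "c \<longlonglongrightarrow> 0" by simp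
  have "\<forall>\<^sub>F n in sequentially. a n < 1/2"
    using order_tendstoD(2)[OF a, of "1/2"] by simp
  then have "\<forall>\<^sub>F n in sequentially. norm (B' n - B) \<le> c n"
  proof eventually_elim
    case (elim n)
    have "0 \<le> gap (T' n) T" "0 \<le> gap (S' n) S"
      using assms by (simp_all add: gap_def gap_delta_nonneg le_max_iff_disj)
    then have "0 \<le> a n" by (simp add: a_def)
    have "norm (B' n - B) \<le> a n * norm (B' n) + norm B * gap (S' n) S"
      unfolding a_def by (intro norm_outer_inverse_diff_le assms)
    \<comment> \<open>The unknown \<open>norm (B' n)\<close> is traded for the difference being
      estimated, whose coefficient \<open>a n\<close> is eventually below 1/2.\<close>
    also have "a n * norm (B' n) \<le> a n * (norm (B' n - B) + norm B)"
      using \<open>0 \<le> a n\<close> norm_triangle_ineq[of "B' n - B" B] by (simp add: mult_left_mono)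
    also have "\<dots> \<le> 1/2 * norm (B' n - B) + a n * norm B"
      using elim mult_right_mono[of "a n" "1/2" "norm (B' n - B)"]
      by (simp add: distrib_left)
    finally show ?case by (simp add: c_def)
  qed
  then have "(\<lambda>n. B' n - B) \<longlonglongrightarrow> 0"
    by (rule Lim_null_comparison[OF _ c])
  then show ?thesis by (rule LIM_zero_cancel)
qed

theorem theorem7p1:
  fixes A :: "'a::banach \<Rightarrow>\<^sub>L 'b::banach"
    and T :: "'a set" and S :: "'b set"
    and A' :: "nat \<Rightarrow> ('a \<Rightarrow>\<^sub>L 'b)"
    and T' :: "nat \<Rightarrow> 'a set" and S' :: "nat \<Rightarrow> 'b set"
  assumes "subspace T" "closed T" "subspace S" "closed S"
    and "outer_inverse_exists A T S"
    and "\<And>n. subspace (T' n)" "\<And>n. closed (T' n)"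
    and "\<And>n. subspace (S' n)" "\<And>n. closed (S' n)"
    and "\<And>n. outer_inverse_exists (A' n) (T' n) (S' n)"
    and "A' \<longlonglongrightarrow> A"
  shows "let B = outer_inverse A T S;
             B' = (\<lambda>n. outer_inverse (A' n) (T' n) (S' n));
             i = (B' \<longlonglongrightarrow> B);
             ii = ((\<lambda>n. B' n o\<^sub>L A' n) \<longlonglongrightarrow> (B o\<^sub>L A) \<and> (\<lambda>n. A' n o\<^sub>L B' n) \<longlonglongrightarrow> (A o\<^sub>L B));
             iii = ((\<lambda>n. B' n o\<^sub>L A' n) \<longlonglongrightarrow> (B o\<^sub>L A) \<and> (\<lambda>n. gap (S' n) S) \<longlonglongrightarrow> 0);
             iv = ((\<lambda>n. A' n o\<^sub>L B' n) \<longlonglongrightarrow> (A o\<^sub>L B) \<and> (\<lambda>n. gap (T' n) T) \<longlonglongrightarrow> 0);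
             v = ((\<lambda>n. gap (T' n) T) \<longlonglongrightarrow> 0 \<and> (\<lambda>n. gap (S' n) S) \<longlonglongrightarrow> 0)
         in (i \<longleftrightarrow> ii) \<and> (i \<longleftrightarrow> iii) \<and> (i \<longleftrightarrow> iv) \<and> (i \<longleftrightarrow> v)"
proof -
  define B where "B = outer_inverse A T S"
  define B' where "B' n = outer_inverse (A' n) (T' n) (S' n)" for n
  have B: "is_outer_inverse A T S B"
    unfolding B_def by (rule is_outer_inverse_outer_inverse) fact
  have B': "is_outer_inverse (A' n) (T' n) (S' n) (B' n)" for n
    unfolding B'_def by (rule is_outer_inverse_outer_inverse) fact
  note D = is_outer_inverseD[OF B] is_outer_inverseD[OF B']
  have T: "(\<lambda>n. gap (T' n) T) \<longlonglongrightarrow> 0" if "(\<lambda>n. B' n o\<^sub>L A' n) \<longlonglongrightarrow> (B o\<^sub>L A)"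
    by (rule gap_projections_tendsto_0[OF _ _ _ _ _ _ that]) (simp_all add: assms D)
  have S: "(\<lambda>n. gap (S' n) S) \<longlonglongrightarrow> 0" if "(\<lambda>n. A' n o\<^sub>L B' n) \<longlonglongrightarrow> (A o\<^sub>L B)"
  proof (rule gap_projections_tendsto_0)
    \<comment> \<open>\<open>S\<close> is the null space of the projection
      \<open>A o\<^sub>L B\<close>, hence the range of its complement; the gap estimate for ranges
      applies to the complements.\<close>
    show "(\<lambda>n. id_blinfun - (A' n o\<^sub>L B' n)) \<longlonglongrightarrow> id_blinfun - (A o\<^sub>L B)"
      by (intro tendsto_intros that)
  qed (simp_all add: assms D blinfun.diff_left blinfun.diff_right)
  have BA: "(\<lambda>n. B' n o\<^sub>L A' n) \<longlonglongrightarrow> (B o\<^sub>L A)" if "B' \<longlonglongrightarrow> B"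
    by (rule bounded_bilinear.tendsto[OF bounded_bilinear_blinfun_compose that assms(11)])
  have AB: "(\<lambda>n. A' n o\<^sub>L B' n) \<longlonglongrightarrow> (A o\<^sub>L B)" if "B' \<longlonglongrightarrow> B"
    by (rule bounded_bilinear.tendsto[OF bounded_bilinear_blinfun_compose assms(11) that])
  have i: "B' \<longlonglongrightarrow> B" if "(\<lambda>n. gap (T' n) T) \<longlonglongrightarrow> 0" "(\<lambda>n. gap (S' n) S) \<longlonglongrightarrow> 0"
    by (rule outer_inverse_tendsto[OF _ _ B _ _ B' _ that]) (simp_all add: assms)
  show ?thesis
    unfolding Let_def B_def[symmetric] B'_def[symmetric]
    \<comment> \<open>Each of (ii), (iii), (iv) yields both gap limits via \<open>T\<close> and
      \<open>S\<close>, hence (v), and (v) yields (i) by \<open>i\<close>. Conversely (i) gives both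
      product limits by \<open>BA\<close> and \<open>AB\<close>, and from them all the rest.\<close>
    using T S BA AB i by blast
qed

end
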